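(* Let $G$ be a group and let $\varphi\in\operatorname{Autcent}(G)$ be an involution. If $\operatorname{Alex}(G,\varphi)$ is connected, then $G$ is abelian.
   Context: A quandle is a set $X$ with a binary operation $*$ such that: (i) $a*a=a$ for all $a\in X$; (ii) for any $a,b\in X$ there is a unique $c\in X$ with $a=c*b$; (iii) $(a*b)*c=(a*c)*(b*c)$ for all $a,b,c\in X$. An automorphism of a quandle $X$ is a bijection $f:X\to X$ with $f(a*b)=f(a)*f(b)$; these form the group $\operatorname{Aut}(X)$ under composition. For $x\in X$, the map $S_x:X\to X$, $S_x(y)=y*x$, is an automorphism of $X$; $\operatorname{Inn}(X)$ denotes the subgroup of $\operatorname{Aut}(X)$ generated by all $S_x$, $x\in X$. A quandle $X$ is connected if $\operatorname{Inn}(X)$ acts transitively on $X$. For a group $G$ and a group automorphism $\varphi$ of $G$, the generalised Alexander quandle $\operatorname{Alex}(G,\varphi)$ is the set $G$ with operation $a*b=\varphi(ab^{-1})b$. An automorphism $\varphi$ of $G$ is central if $a^{-1}\varphi(a)\in \mathrm{Z}(G)$ for all $a\in G$, where $\mathrm{Z}(G)$ is the center of $G$; $\operatorname{Autcent}(G)$ is the group of central automorphisms of $G$. An involution is an automorphism $\varphi$ with $\varphi^2=\mathrm{id}_G$. *)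

theory Defs
  imports "HOL-Algebra.Group_Action" "HOL-Algebra.Generated_Groups"
begin

section \<open>Quandles\<close>

record 'a quandle_struct = "'a partial_object" +
  qop :: "'a \<Rightarrow> 'a \<Rightarrow> 'a" (infixl "\<rhd>\<index>" 70)

locale quandle =
  fixes X (structure)
  assumes closed: "\<lbrakk>a \<in> carrier X; b \<in> carrier X\<rbrakk> \<Longrightarrow> a \<rhd> b \<in> carrier X"
    and idem: "a \<in> carrier X \<Longrightarrow> a \<rhd> a = a"
    and unique_left: "\<lbrakk>a \<in> carrier X; b \<in> carrier X\<rbrakk> \<Longrightarrow> \<exists>!c. c \<in> carrier X \<and> a = c \<rhd> b"
    and distrib: "\<lbrakk>a \<in> carrier X; b \<in> carrier X; c \<in> carrier X\<rbrakk>
      \<Longrightarrow> (a \<rhd> b) \<rhd> c = (a \<rhd> c) \<rhd> (b \<rhd> c)"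

text \<open>As in \<^theory>\<open>HOL-Algebra.Bij\<close>, automorphisms are extensional functions on the carrier,
  and the group operation is composition.\<close>

definition quandle_auto :: "('a, 'b) quandle_struct_scheme \<Rightarrow> ('a \<Rightarrow> 'a) set"
  where "quandle_auto X =
    {f \<in> Bij (carrier X). \<forall>a\<in>carrier X. \<forall>b\<in>carrier X. f (a \<rhd>\<^bsub>X\<^esub> b) = f a \<rhd>\<^bsub>X\<^esub> f b}"

definition quandle_Aut :: "('a, 'b) quandle_struct_scheme \<Rightarrow> ('a \<Rightarrow> 'a) monoid"
  where "quandle_Aut X = BijGroup (carrier X) \<lparr>carrier := quandle_auto X\<rparr>"

definition right_mult :: "('a, 'b) quandle_struct_scheme \<Rightarrow> 'a \<Rightarrow> 'a \<Rightarrow> 'a"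
  where "right_mult X x = (\<lambda>y\<in>carrier X. y \<rhd>\<^bsub>X\<^esub> x)"

definition quandle_Inn :: "('a, 'b) quandle_struct_scheme \<Rightarrow> ('a \<Rightarrow> 'a) monoid"
  where "quandle_Inn X = subgroup_generated (quandle_Aut X) (right_mult X ` carrier X)"

locale connected_quandle = quandle X + transitive_action "quandle_Inn X" "carrier X" "\<lambda>f. f"
  for X (structure)


section \<open>Central automorphisms and generalised Alexander quandles\<close>

definition center :: "('a, 'b) monoid_scheme \<Rightarrow> 'a set"
  where "center G = {z \<in> carrier G. \<forall>g\<in>carrier G. z \<otimes>\<^bsub>G\<^esub> g = g \<otimes>\<^bsub>G\<^esub> z}"

definition Autcent :: "('a, 'b) monoid_scheme \<Rightarrow> ('a \<Rightarrow> 'a) set"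
  where "Autcent G = {\<phi> \<in> auto G. \<forall>a\<in>carrier G. inv\<^bsub>G\<^esub> a \<otimes>\<^bsub>G\<^esub> \<phi> a \<in> center G}"

text \<open>The identity counts as an involution.\<close>

definition involution :: "('a, 'b) monoid_scheme \<Rightarrow> ('a \<Rightarrow> 'a) \<Rightarrow> bool"
  where "involution G \<phi> \<longleftrightarrow>
    \<phi> \<in> auto G \<and> compose (carrier G) \<phi> \<phi> = (\<lambda>x\<in>carrier G. x)"

definition Alex :: "('a, 'b) monoid_scheme \<Rightarrow> ('a \<Rightarrow> 'a) \<Rightarrow> 'a quandle_struct"
  where "Alex G \<phi> =
    \<lparr>carrier = carrier G, qop = \<lambda>a b. \<phi> (a \<otimes>\<^bsub>G\<^esub> inv\<^bsub>G\<^esub> b) \<otimes>\<^bsub>G\<^esub> b\<rparr>"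


section \<open>Basic facts\<close>

context quandle
begin

lemma right_mult_auto:
  assumes "x \<in> carrier X"
  shows "right_mult X x \<in> quandle_auto X"
proof -
  have "bij_betw (right_mult X x) (carrier X) (carrier X)"
    unfolding bij_betw_def inj_on_def right_mult_def image_def
    using closed[OF _ assms] unique_left[OF _ assms] by (auto, metis+)
  then show ?thesis
    using assms closed by (auto simp: quandle_auto_def Bij_def right_mult_def distrib[of _ _ x])
qed

lemma subgroup_quandle_auto: "subgroup (quandle_auto X) (BijGroup (carrier X))"
proof (rule subgroup.intro)
  show "quandle_auto X \<subseteq> carrier (BijGroup (carrier X))"
    by (auto simp: quandle_auto_def BijGroup_def)
next
  fix f g assume "f \<in> quandle_auto X" "g \<in> quandle_auto X"
  then show "f \<otimes>\<^bsub>BijGroup (carrier X)\<^esub> g \<in> quandle_auto X"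
    using closed Bij_imp_funcset[of g "carrier X"]
    by (auto simp: quandle_auto_def BijGroup_def compose_Bij compose_eq Pi_iff)
next
  show "\<one>\<^bsub>BijGroup (carrier X)\<^esub> \<in> quandle_auto X"
    using closed by (auto simp: quandle_auto_def BijGroup_def id_Bij)
next
  fix f assume f: "f \<in> quandle_auto X"
  then have "f \<in> Bij (carrier X)"
    by (simp add: quandle_auto_def)
  moreover have "inv_into (carrier X) f (a \<rhd> b) = inv_into (carrier X) f a \<rhd> inv_into (carrier X) f b"
    if "a \<in> carrier X" "b \<in> carrier X" for a b
    using f that closed
    by (intro Bij_inv_into_lemma[where g = "qop X"]) (auto simp: quandle_auto_def)
  ultimately show "inv\<^bsub>BijGroup (carrier X)\<^esub> f \<in> quandle_auto X"
    using closed by (auto simp: quandle_auto_def inv_BijGroup restrict_inv_into_Bij Bij_inv_into_mem)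
qed

lemma group_quandle_Aut: "group (quandle_Aut X)"
  unfolding quandle_Aut_def
  by (rule subgroup.subgroup_is_group[OF subgroup_quandle_auto group_BijGroup])

lemma carrier_quandle_Inn:
  "carrier (quandle_Inn X) = generate (quandle_Aut X) (right_mult X ` carrier X)"
proof -
  have "carrier (quandle_Aut X) \<inter> right_mult X ` carrier X = right_mult X ` carrier X"
    using right_mult_auto by (auto simp: quandle_Aut_def)
  then show ?thesis
    by (simp add: quandle_Inn_def carrier_subgroup_generated)
qed

lemma group_action_quandle_Inn: "group_action (quandle_Inn X) (carrier X) (\<lambda>f. f)"
proof -
  interpret A: group "quandle_Aut X" by (rule group_quandle_Aut)
  have Inn: "group (quandle_Inn X)"
    by (simp add: quandle_Inn_def)
  have sub: "carrier (quandle_Inn X) \<subseteq> quandle_auto X"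
    using A.carrier_subgroup_generated_subset[of "right_mult X ` carrier X"]
    by (simp add: quandle_Inn_def quandle_Aut_def)
  have "(\<lambda>f. f) \<in> hom (quandle_Inn X) (BijGroup (carrier X))"
    using sub
    by (auto simp: hom_def quandle_Inn_def quandle_Aut_def subgroup_generated_def
        BijGroup_def quandle_auto_def)
  then show ?thesis
    using Inn group_BijGroup
    by (simp add: group_action_def group_hom_def group_hom_axioms_def)
qed

lemma connected_quandle_iff:
  "connected_quandle X \<longleftrightarrow>
    (\<forall>x\<in>carrier X. \<forall>y\<in>carrier X.
      \<exists>f\<in>generate (quandle_Aut X) (right_mult X ` carrier X). f x = y)"
  using group_action_quandle_Inn quandle_axioms
  by (auto simp: connected_quandle_def transitive_action_def transitive_action_axioms_def
      carrier_quandle_Inn)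

end

lemma (in group) quandle_Alex:
  assumes "\<phi> \<in> auto G"
  shows "quandle (Alex G \<phi>)"
proof -
  have hom: "\<phi> \<in> hom G G" and bij: "bij_betw \<phi> (carrier G) (carrier G)"
    using assms by (auto simp: auto_def Bij_def)
  interpret group_hom G G \<phi>
    using hom by unfold_locales
  note [simp] = inv_mult_group m_assoc
  show ?thesis
  proof
    fix a b assume a: "a \<in> carrier (Alex G \<phi>)" and b: "b \<in> carrier (Alex G \<phi>)"
    then have ab: "a \<in> carrier G" "b \<in> carrier G" by (auto simp: Alex_def)
    then show "a \<rhd>\<^bsub>Alex G \<phi>\<^esub> b \<in> carrier (Alex G \<phi>)"
      by (simp add: Alex_def)
    have "a \<otimes> inv b \<in> \<phi> ` carrier G"
      using bij ab by (simp add: bij_betw_imp_surj_on)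
    then obtain d where d: "d \<in> carrier G" "\<phi> d = a \<otimes> inv b"
      by auto
    show "\<exists>!c. c \<in> carrier (Alex G \<phi>) \<and> a = c \<rhd>\<^bsub>Alex G \<phi>\<^esub> b"
    proof (rule ex1I[of _ "d \<otimes> b"])
      have "d \<otimes> b \<otimes> inv b = d" using ab d by simp
      moreover have "\<phi> d \<otimes> b = a" using ab d by simp
      ultimately show "d \<otimes> b \<in> carrier (Alex G \<phi>) \<and> a = (d \<otimes> b) \<rhd>\<^bsub>Alex G \<phi>\<^esub> b"
        using ab d by (simp add: Alex_def)
    next
      fix c assume c: "c \<in> carrier (Alex G \<phi>) \<and> a = c \<rhd>\<^bsub>Alex G \<phi>\<^esub> b"
      then have cG: "c \<in> carrier G" and eq: "a = \<phi> (c \<otimes> inv b) \<otimes> b"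
        by (auto simp: Alex_def)
      have "\<phi> (c \<otimes> inv b) = \<phi> d"
        unfolding d(2) by (rule inv_solve_right[THEN iffD2, OF _ _ _ eq]) (use ab cG in simp_all)
      then have "c \<otimes> inv b = d"
        by (rule inj_onD[OF bij_betw_imp_inj_on[OF bij]]) (use ab cG d in simp_all)
      then show "c = d \<otimes> b"
        using ab cG by auto
    qed
  next
    fix a assume "a \<in> carrier (Alex G \<phi>)"
    then show "a \<rhd>\<^bsub>Alex G \<phi>\<^esub> a = a"
      by (simp add: Alex_def)
  next
    fix a b c
    assume "a \<in> carrier (Alex G \<phi>)" "b \<in> carrier (Alex G \<phi>)" "c \<in> carrier (Alex G \<phi>)"
    then have abc: "a \<in> carrier G" "b \<in> carrier G" "c \<in> carrier G"
      by (auto simp: Alex_def)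
    have cancel: "x \<otimes> (inv x \<otimes> y) = y" "inv x \<otimes> (x \<otimes> y) = y"
      if "x \<in> carrier G" "y \<in> carrier G" for x y
      using that by (simp_all flip: m_assoc)
    from abc show "a \<rhd>\<^bsub>Alex G \<phi>\<^esub> b \<rhd>\<^bsub>Alex G \<phi>\<^esub> c
        = a \<rhd>\<^bsub>Alex G \<phi>\<^esub> c \<rhd>\<^bsub>Alex G \<phi>\<^esub> (b \<rhd>\<^bsub>Alex G \<phi>\<^esub> c)"
      by (simp add: Alex_def cancel)
  qed
qed

end

theory Submission
  imports Defs
begin

text \<open>
  If \<open>\<phi>\<close> is central, then right multiplication in the quandle of \<open>\<phi>\<close> moves a point only inside its
  coset of the center: writing \<open>w = y x\<^sup>-\<^sup>1\<close>, the element \<open>z = w\<^sup>-\<^sup>1 \<phi>(w)\<close> is central, and therefore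
  \<open>y \<rhd> x = \<phi>(w) x = w z x = y z\<close>. Hence the center itself is a union of orbits of the inner
  automorphism group. When the quandle is connected there is a single orbit, namely the whole of
  \<open>G\<close>; as the center contains \<open>\<one>\<close>, it must be everything.
\<close>

text \<open>
  The condition is an equivalence because the inner automorphism group is generated as a group:
  a set that is only mapped into itself by right multiplications may fail to be mapped into itself
  by their inverses.
\<close>

lemma (in quandle) inner_auto_preserves:
  assumes f: "f \<in> generate (quandle_Aut X) (right_mult X ` carrier X)"
    and P: "\<And>x y. \<lbrakk>x \<in> carrier X; y \<in> carrier X\<rbrakk> \<Longrightarrow> y \<rhd> x \<in> P \<longleftrightarrow> y \<in> P"
    and y: "y \<in> carrier X"
  shows "f y \<in> P \<longleftrightarrow> y \<in> P"
proof -
  interpret A: group "quandle_Aut X" by (rule group_quandle_Aut)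
  have gens: "right_mult X ` carrier X \<subseteq> carrier (quandle_Aut X)"
    using right_mult_auto by (auto simp: quandle_Aut_def)
  have maps: "g u \<in> carrier X" if "g \<in> carrier (quandle_Aut X)" "u \<in> carrier X" for g u
    using that Bij_imp_funcset[of g "carrier X"]
    by (auto simp: quandle_Aut_def quandle_auto_def)
  have comp: "(g \<otimes>\<^bsub>quandle_Aut X\<^esub> h) u = g (h u)"
    if "g \<in> carrier (quandle_Aut X)" "h \<in> carrier (quandle_Aut X)" "u \<in> carrier X" for g h u
    using that by (simp add: quandle_Aut_def quandle_auto_def BijGroup_def compose_eq)
  have id: "\<one>\<^bsub>quandle_Aut X\<^esub> u = u" if "u \<in> carrier X" for u
    using that by (simp add: quandle_Aut_def BijGroup_def)
  have gen: "g u \<in> P \<longleftrightarrow> u \<in> P" if "g \<in> right_mult X ` carrier X" "u \<in> carrier X" for g u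
    using that P by (auto simp: right_mult_def)
  show ?thesis
    using f y
  proof (induction f arbitrary: y rule: generate.induct)
    case one
    then show ?case by (simp add: id)
  next
    case (incl h)
    then show ?case by (rule gen)
  next
    case (inv h)
    then have h: "h \<in> carrier (quandle_Aut X)" using gens by blast
    let ?u = "(inv\<^bsub>quandle_Aut X\<^esub> h) y"
    have "h ?u = y"
      using comp[OF h A.inv_closed[OF h] inv.prems] by (simp add: h id inv.prems)
    then show ?case
      using gen[OF inv.hyps(1), of ?u] maps[OF A.inv_closed[OF h] inv.prems] by simp
  next
    case (eng g h)
    then have "g \<in> carrier (quandle_Aut X)" "h \<in> carrier (quandle_Aut X)"
      using A.generate_in_carrier[OF gens] by auto
    then show ?case
      using eng comp maps by simp
  qed
qed

lemma (in group) subgroup_center: "subgroup (center G) G"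
proof
  show "center G \<subseteq> carrier G" "\<one> \<in> center G"
    by (auto simp: center_def)
next
  fix x y assume "x \<in> center G" "y \<in> center G"
  then have x: "x \<in> carrier G" "\<And>g. g \<in> carrier G \<Longrightarrow> x \<otimes> g = g \<otimes> x"
    and y: "y \<in> carrier G" "\<And>g. g \<in> carrier G \<Longrightarrow> y \<otimes> g = g \<otimes> y"
    by (auto simp: center_def)
  have "x \<otimes> y \<otimes> g = g \<otimes> (x \<otimes> y)" if g: "g \<in> carrier G" for g
  proof -
    have "x \<otimes> y \<otimes> g = x \<otimes> g \<otimes> y" using x(1) y g by (simp add: m_assoc)
    also have "\<dots> = g \<otimes> x \<otimes> y" by (simp only: x(2)[OF g])
    finally show ?thesis using x(1) y(1) g by (simp add: m_assoc)
  qed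
  then show "x \<otimes> y \<in> center G" using x(1) y(1) by (simp add: center_def)
next
  fix x assume "x \<in> center G"
  then have x: "x \<in> carrier G" "\<And>g. g \<in> carrier G \<Longrightarrow> x \<otimes> g = g \<otimes> x"
    by (auto simp: center_def)
  have "inv x \<otimes> g = g \<otimes> inv x" if g: "g \<in> carrier G" for g
  proof -
    have "inv (x \<otimes> inv g) = inv (inv g \<otimes> x)"
      by (simp only: x(2)[OF inv_closed[OF g]])
    then show ?thesis using x(1) g by (simp add: inv_mult_group)
  qed
  then show "inv x \<in> center G" using x(1) by (simp add: center_def)
qed

text \<open>
  The witness is \<open>z = w\<^sup>-\<^sup>1 \<phi>(w)\<close> for the quotient \<open>w = y x\<^sup>-\<^sup>1\<close>: since \<open>z\<close> commutes with
  \<open>x\<close>, the factor \<open>x\<close> can cancel the \<open>x\<^sup>-\<^sup>1\<close> in \<open>w\<close>.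
\<close>

lemma (in group) Alex_qop_central_translate:
  assumes \<phi>: "\<phi> \<in> Autcent G" and x: "x \<in> carrier G" and y: "y \<in> carrier G"
  obtains z where "z \<in> center G" "y \<rhd>\<^bsub>Alex G \<phi>\<^esub> x = y \<otimes> z"
proof
  let ?w = "y \<otimes> inv x"
  let ?z = "inv ?w \<otimes> \<phi> ?w"
  have w: "?w \<in> carrier G" using x y by simp
  show z: "?z \<in> center G" using \<phi> w by (simp add: Autcent_def)
  have zG: "?z \<in> carrier G" using z by (simp add: center_def)
  have "\<phi> ?w \<in> carrier G"
    using \<phi> w by (auto simp: Autcent_def auto_def hom_def)
  then have "\<phi> ?w \<otimes> x = ?w \<otimes> ?z \<otimes> x"
    using w by (simp add: m_assoc[symmetric])
  also have "\<dots> = ?w \<otimes> (?z \<otimes> x)"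
    using w zG x by (rule m_assoc)
  also have "?z \<otimes> x = x \<otimes> ?z"
    using z x by (simp add: center_def)
  also have "?w \<otimes> (x \<otimes> ?z) = ?w \<otimes> x \<otimes> ?z"
    using w x zG by (rule m_assoc[symmetric])
  also have "?w \<otimes> x = y"
    using x y by (simp add: m_assoc)
  finally show "y \<rhd>\<^bsub>Alex G \<phi>\<^esub> x = y \<otimes> ?z" by (simp add: Alex_def)
qed

lemma (in group) Alex_qop_mem_center_iff:
  assumes "\<phi> \<in> Autcent G" "x \<in> carrier G" "y \<in> carrier G"
  shows "y \<rhd>\<^bsub>Alex G \<phi>\<^esub> x \<in> center G \<longleftrightarrow> y \<in> center G"
proof -
  interpret Z: subgroup "center G" G by (rule subgroup_center)
  obtain z where z: "z \<in> center G" "y \<rhd>\<^bsub>Alex G \<phi>\<^esub> x = y \<otimes> z"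
    using assms by (rule Alex_qop_central_translate)
  have "y = (y \<otimes> z) \<otimes> inv z"
    using assms z Z.mem_carrier by (simp add: m_assoc)
  then show ?thesis
    using z by (metis Z.m_closed Z.m_inv_closed)
qed

theorem theorem5p4:
  fixes G (structure) and \<phi> :: "'a \<Rightarrow> 'a"
  assumes "group G"
    and "\<phi> \<in> Autcent G"
    and "involution G \<phi>"
    and "connected_quandle (Alex G \<phi>)"
  shows "comm_group G"
proof -
  interpret group G by fact
  interpret Q: quandle "Alex G \<phi>"
    using assms(4) by (simp add: connected_quandle_def)
  have car: "carrier (Alex G \<phi>) = carrier G" by (simp add: Alex_def)
  have one: "\<one> \<in> center G" by (rule subgroup.one_closed[OF subgroup_center])
  have central: "g \<in> center G" if g: "g \<in> carrier G" for g
  proof -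
    obtain f where f: "f \<in> generate (quandle_Aut (Alex G \<phi>))
        (right_mult (Alex G \<phi>) ` carrier (Alex G \<phi>))" and "f \<one> = g"
      using assms(4) g unfolding Q.connected_quandle_iff car by blast
    moreover have "f \<one> \<in> center G \<longleftrightarrow> \<one> \<in> center G"
      by (rule Q.inner_auto_preserves[OF f])
        (simp_all add: car Alex_qop_mem_center_iff[OF assms(2)])
    ultimately show ?thesis using one by simp
  qed
  show ?thesis
    by (rule group_comm_groupI) (use central in \<open>auto simp: center_def\<close>)
qed

end
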